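(* For every integer $n \ge 0$, $|\mathfrak{D}^4_{2n}(1243)| = |\mathfrak{D}^4_{2n}(1324)| = 2\binom{n}{2}+1 = n^2-n+1$.
   Context: A permutation $\pi$ of $[N]=\{1,\dots,N\}$ is written as $\pi(1)\pi(2)\cdots\pi(N)$. A Dumont permutation of the fourth kind (Dumont-4 permutation) of size $2n$ is a permutation $\pi$ of $[2n]$ in which all deficiencies are even values at even positions: for all $1\le i\le 2n$, if $\pi(i)<i$ then both $i$ and $\pi(i)$ are even. The set of these is $\mathfrak{D}^4_{2n}$ (for $n=0$ it consists of the empty permutation). A permutation $\pi$ of $[N]$ contains a pattern $\tau\in S_k$ if there are indices $i_1<\dots<i_k$ such that for all $a,b$, $\pi(i_a)<\pi(i_b)$ if and only if $\tau(a)<\tau(b)$; otherwise $\pi$ avoids $\tau$. $\mathfrak{D}^4_{2n}(\tau)$ denotes the set of permutations in $\mathfrak{D}^4_{2n}$ avoiding $\tau$. *)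

theory Defs
  imports "HOL-Combinatorics.Permutations"
begin

text \<open>A permutation of \<open>[N]\<close> is a function \<open>\<pi>\<close> with \<open>\<pi> permutes {1..N}\<close>; since such
  functions are the identity outside \<open>{1..N}\<close>, distinct functions are distinct permutations.\<close>

definition dumont4 :: "nat \<Rightarrow> (nat \<Rightarrow> nat) set" where
  "dumont4 n = {\<pi>. \<pi> permutes {1..2*n} \<and>
     (\<forall>i\<in>{1..2*n}. \<pi> i < i \<longrightarrow> even i \<and> even (\<pi> i))}"

text \<open>The pattern \<open>\<tau>\<close> is given in one-line notation as a list, so the index \<open>a \<in> {1..k}\<close> of
  the usual definition becomes the list position \<open>a - 1\<close>.\<close>

definition contains_pattern :: "nat \<Rightarrow> (nat \<Rightarrow> nat) \<Rightarrow> nat list \<Rightarrow> bool" where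
  "contains_pattern N \<pi> \<tau> \<longleftrightarrow>
     (\<exists>i :: nat \<Rightarrow> nat. strict_mono_on {..<length \<tau>} i \<and> i ` {..<length \<tau>} \<subseteq> {1..N} \<and>
        (\<forall>a<length \<tau>. \<forall>b<length \<tau>. \<pi> (i a) < \<pi> (i b) \<longleftrightarrow> \<tau> ! a < \<tau> ! b))"

definition dumont4_avoiding :: "nat \<Rightarrow> nat list \<Rightarrow> (nat \<Rightarrow> nat) set" where
  "dumont4_avoiding n \<tau> = {\<pi> \<in> dumont4 n. \<not> contains_pattern (2*n) \<pi> \<tau>}"

end

theory Submission
  imports Defs
begin

text \<open>
  In a Dumont-4 permutation no odd value can lie to the right of its own position, so the value
  1 is fixed and can serve as the smallest letter of any pattern that starts with its minimum.
  Avoiding 1243 or 1324 therefore means that the letters from position 2 on avoid 132 or 213,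
  respectively. Together with the parity conditions this forces the permutation to be increasing
  away from at most two positions: for 1243, away from position 2 and the position \<open>q\<close> of the
  value 2; for 1324, writing \<open>s\<close> for the least non-fixed point, between position \<open>s\<close> and position
  \<open>2n - 1\<close> away from the position \<open>p\<close> of the value \<open>2n\<close>, where the value \<open>s\<close> comes last.

  A permutation that increases on a set of positions is determined by its values elsewhere, so an
  avoider is determined by two numbers, \<open>(\<pi>(2), q)\<close> or \<open>(s, p)\<close>. In both cases it is a cycle on an
  interval (with one extra point for 1243) that shifts letters up by one. Apart from the identity,
  the admissible pairs fall into \<open>n\<close> rows (indexed by the even one of the two parameters) of sizes
  \<open>0, 2, \<dots>, 2(n - 1)\<close>, hence the count \<open>n(n - 1) + 1\<close>.
\<close>

section \<open>Permutations that increase on a set of positions\<close>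

text \<open>Both permutations map the set onto the same values, the complement of what is taken outside
  it; an increasing enumeration of a given set of values is unique.\<close>

lemma bij_eqI_strict_mono_on:
  fixes f g :: "'a::wellorder \<Rightarrow> 'b::linorder"
  assumes f: "bij f" and g: "bij g"
    and off: "\<And>x. x \<notin> A \<Longrightarrow> f x = g x"
    and mf: "strict_mono_on A f" and mg: "strict_mono_on A g"
  shows "f = g"
proof -
  have "f ` (- A) = g ` (- A)"
    using off by (auto simp: image_iff)
  then have img: "f ` A = g ` A"
    using bij_image_Compl_eq[OF f, of "- A"] bij_image_Compl_eq[OF g, of "- A"] by simp
  have on: "f x = g x" if "x \<in> A" for x
    using that
  proof (induction x rule: less_induct)
    case (less x)
    obtain y where y: "y \<in> A" "f x = g y" using img less.prems by blast
    obtain z where z: "z \<in> A" "g x = f z" using img less.prems by blast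
    have "\<not> y < x"
      using less.IH[of y] y less.prems f by (metis bij_is_inj inj_eq less_irrefl)
    moreover have "\<not> z < x"
      using less.IH[of z] z less.prems g by (metis bij_is_inj inj_eq less_irrefl)
    ultimately have "g x \<le> f x" "f x \<le> g x"
      using y z less.prems strict_mono_on_leD[OF mf, of x z] strict_mono_on_leD[OF mg, of x y]
      by auto
    then show ?case by simp
  qed
  show ?thesis
    using on off by blast
qed

lemma permutesI_inj_on:
  assumes "finite S" "\<And>x. x \<in> S \<Longrightarrow> f x \<in> S" "inj_on f S" "\<And>x. x \<notin> S \<Longrightarrow> f x = x"
  shows "f permutes S"
proof (rule bij_imp_permutes)
  have "f ` S \<subseteq> S" using assms(2) by blast
  then show "bij_betw f S S"
    using endo_inj_surj[OF assms(1)] assms(3) by (simp add: bij_betw_def)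
qed (use assms(4) in blast)

section \<open>The two patterns in terms of positions\<close>

lemma contains_pattern_1243_iff:
  "contains_pattern N \<pi> [1,2,4,3] \<longleftrightarrow>
     (\<exists>a b c d. 1 \<le> a \<and> a < b \<and> b < c \<and> c < d \<and> d \<le> N \<and> \<pi> a < \<pi> b \<and> \<pi> b < \<pi> d \<and> \<pi> d < \<pi> c)"
  (is "_ \<longleftrightarrow> ?R")
proof
  assume "contains_pattern N \<pi> [1,2,4,3]"
  then obtain i where m: "strict_mono_on {..<4} i" and r: "i ` {..<4} \<subseteq> {1..N}"
    and o: "\<forall>a<4. \<forall>b<4. \<pi> (i a) < \<pi> (i b) \<longleftrightarrow> [1,2,4,3::nat] ! a < [1,2,4,3] ! b"
    unfolding contains_pattern_def by (simp add: numeral_eq_Suc del: One_nat_def) blast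
  have "i 0 < i 1" "i 1 < i 2" "i 2 < i 3"
    using m by (auto simp: strict_mono_on_def)
  moreover have "1 \<le> i 0" "i 3 \<le> N"
    using r by (auto simp: image_subset_iff)
  moreover have "\<pi> (i 0) < \<pi> (i 1)" "\<pi> (i 1) < \<pi> (i 3)" "\<pi> (i 3) < \<pi> (i 2)"
    using o by auto
  ultimately show ?R by blast
next
  assume ?R
  then obtain a b c d where *: "1 \<le> a" "a < b" "b < c" "c < d" "d \<le> N"
      "\<pi> a < \<pi> b" "\<pi> b < \<pi> d" "\<pi> d < \<pi> c"
    by blast
  have "strict_mono_on {..<4} (\<lambda>k. [a,b,c,d] ! k)"
    using * by (auto simp: strict_mono_on_def less_Suc_eq numeral_eq_Suc)
  moreover have "(\<lambda>k. [a,b,c,d] ! k) ` {..<4} \<subseteq> {1..N}"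
    using * by (auto simp: less_Suc_eq numeral_eq_Suc)
  ultimately show "contains_pattern N \<pi> [1,2,4,3]"
    unfolding contains_pattern_def using *
    by (intro exI[of _ "\<lambda>k. [a,b,c,d] ! k"]) (auto simp: less_Suc_eq numeral_eq_Suc)
qed

lemma contains_pattern_1324_iff:
  "contains_pattern N \<pi> [1,3,2,4] \<longleftrightarrow>
     (\<exists>a b c d. 1 \<le> a \<and> a < b \<and> b < c \<and> c < d \<and> d \<le> N \<and> \<pi> a < \<pi> c \<and> \<pi> c < \<pi> b \<and> \<pi> b < \<pi> d)"
  (is "_ \<longleftrightarrow> ?R")
proof
  assume "contains_pattern N \<pi> [1,3,2,4]"
  then obtain i where m: "strict_mono_on {..<4} i" and r: "i ` {..<4} \<subseteq> {1..N}"
    and o: "\<forall>a<4. \<forall>b<4. \<pi> (i a) < \<pi> (i b) \<longleftrightarrow> [1,3,2,4::nat] ! a < [1,3,2,4] ! b"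
    unfolding contains_pattern_def by (simp add: numeral_eq_Suc del: One_nat_def) blast
  have "i 0 < i 1" "i 1 < i 2" "i 2 < i 3"
    using m by (auto simp: strict_mono_on_def)
  moreover have "1 \<le> i 0" "i 3 \<le> N"
    using r by (auto simp: image_subset_iff)
  moreover have "\<pi> (i 0) < \<pi> (i 2)" "\<pi> (i 2) < \<pi> (i 1)" "\<pi> (i 1) < \<pi> (i 3)"
    using o by auto
  ultimately show ?R by blast
next
  assume ?R
  then obtain a b c d where *: "1 \<le> a" "a < b" "b < c" "c < d" "d \<le> N"
      "\<pi> a < \<pi> c" "\<pi> c < \<pi> b" "\<pi> b < \<pi> d"
    by blast
  have "strict_mono_on {..<4} (\<lambda>k. [a,b,c,d] ! k)"
    using * by (auto simp: strict_mono_on_def less_Suc_eq numeral_eq_Suc)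
  moreover have "(\<lambda>k. [a,b,c,d] ! k) ` {..<4} \<subseteq> {1..N}"
    using * by (auto simp: less_Suc_eq numeral_eq_Suc)
  ultimately show "contains_pattern N \<pi> [1,3,2,4]"
    unfolding contains_pattern_def using *
    by (intro exI[of _ "\<lambda>k. [a,b,c,d] ! k"]) (auto simp: less_Suc_eq numeral_eq_Suc)
qed

section \<open>Dumont-4 permutations\<close>

lemma dumont4_permutes: "\<pi> \<in> dumont4 n \<Longrightarrow> \<pi> permutes {1..2*n}"
  by (simp add: dumont4_def)

lemma dumont4_deficiency_even:
  assumes "\<pi> \<in> dumont4 n" "\<pi> i < i"
  shows "even i" "even (\<pi> i)"
proof -
  have "i \<in> {1..2*n}"
    using assms permutes_not_in[OF dumont4_permutes] by fastforce
  then show "even i" "even (\<pi> i)"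
    using assms by (auto simp: dumont4_def)
qed

lemma dumont4_odd_position: "\<pi> \<in> dumont4 n \<Longrightarrow> odd i \<Longrightarrow> i \<le> \<pi> i"
  using dumont4_deficiency_even(1) not_le by blast

lemma dumont4_odd_value: "\<pi> \<in> dumont4 n \<Longrightarrow> odd (\<pi> i) \<Longrightarrow> i \<le> \<pi> i"
  using dumont4_deficiency_even(2) not_le by blast

lemma dumont4_in_range:
  assumes "\<pi> \<in> dumont4 n" "i \<in> {1..2*n}"
  shows "\<pi> i \<in> {1..2*n}"
  using permutes_in_image[OF dumont4_permutes[OF assms(1)]] assms(2) by blast

lemma dumont4_zero_fixed: "\<pi> \<in> dumont4 n \<Longrightarrow> \<pi> 0 = 0"
  using permutes_not_in[OF dumont4_permutes, of \<pi> n 0] by simp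

lemma dumont4_one_fixed:
  assumes "\<pi> \<in> dumont4 n"
  shows "\<pi> 1 = 1"
proof -
  obtain i where i: "\<pi> i = 1"
    using permutes_surj[OF dumont4_permutes[OF assms]] by (metis surj_def)
  then have "i \<le> 1" using dumont4_odd_value[OF assms, of i] by simp
  moreover have "i \<noteq> 0" using dumont4_zero_fixed[OF assms] i by (intro notI) auto
  ultimately show ?thesis using i by (metis le_less less_one)
qed

lemma dumont4_inj: "\<pi> \<in> dumont4 n \<Longrightarrow> \<pi> x = \<pi> y \<longleftrightarrow> x = y"
  using permutes_inj[OF dumont4_permutes] by (simp add: inj_eq)

lemma dumont4_ge_2:
  assumes "\<pi> \<in> dumont4 n" "2 \<le> i"
  shows "2 \<le> \<pi> i"
  using dumont4_inj[OF assms(1), of i 0] dumont4_inj[OF assms(1), of i 1]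
    dumont4_zero_fixed[OF assms(1)] dumont4_one_fixed[OF assms(1)] assms(2)
  by linarith

lemma dumont4_zero: "dumont4 0 = {id}"
  by (auto simp: dumont4_def)

lemma dumont4_avoiding_1243_no_132:
  assumes "\<pi> \<in> dumont4_avoiding n [1,2,4,3]"
    and "2 \<le> b" "b < c" "c < d" "d \<le> 2*n"
  shows "\<not> (\<pi> b < \<pi> d \<and> \<pi> d < \<pi> c)"
proof -
  have D: "\<pi> \<in> dumont4 n" using assms(1) by (simp add: dumont4_avoiding_def)
  have "\<pi> 1 < \<pi> b"
    using dumont4_ge_2[OF D \<open>2 \<le> b\<close>] dumont4_one_fixed[OF D] by simp
  moreover have "1 \<le> (1::nat)" "1 < b" using assms by simp_all
  ultimately show ?thesis
    using assms unfolding dumont4_avoiding_def contains_pattern_1243_iff by blast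
qed

lemma dumont4_avoiding_1324_no_213:
  assumes "\<pi> \<in> dumont4_avoiding n [1,3,2,4]"
    and "2 \<le> b" "b < c" "c < d" "d \<le> 2*n"
  shows "\<not> (\<pi> c < \<pi> b \<and> \<pi> b < \<pi> d)"
proof -
  have D: "\<pi> \<in> dumont4 n" using assms(1) by (simp add: dumont4_avoiding_def)
  have "\<pi> 1 < \<pi> c"
    using dumont4_ge_2[OF D, of c] dumont4_one_fixed[OF D] assms(2,3) by simp
  moreover have "1 \<le> (1::nat)" "1 < b" using assms by simp_all
  ultimately show ?thesis
    using assms unfolding dumont4_avoiding_def contains_pattern_1324_iff by blast
qed

section \<open>Avoiding 1243\<close>

text \<open>For \<open>3 \<le> k \<le> q\<close> this is the cycle \<open>2 \<mapsto> k \<mapsto> k + 1 \<mapsto> \<dots> \<mapsto> q \<mapsto> 2\<close>; the pair \<open>(2, 2)\<close> gives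
  the identity.\<close>

definition cycle_from_2 :: "nat \<Rightarrow> nat \<Rightarrow> nat \<Rightarrow> nat" where
  "cycle_from_2 k q i =
     (if i = 2 then k else if i = q then 2 else if k \<le> i \<and> i < q then i + 1 else i)"

definition params_1243 :: "nat \<Rightarrow> (nat \<times> nat) set" where
  "params_1243 n = insert (2, 2) ((\<lambda>(d, k). (k, 2*d + 2)) ` (SIGMA d:{..<n}. {3..2*d + 2}))"

lemma params_1243_iff:
  assumes "0 < n"
  shows "(k, q) \<in> params_1243 n \<longleftrightarrow>
     k = 2 \<and> q = 2 \<or> 3 \<le> k \<and> k \<le> q \<and> even q \<and> q \<le> 2*n"
proof -
  have "(k, q) \<in> params_1243 n" if *: "3 \<le> k" "k \<le> q" "even q" "q \<le> 2*n"
  proof -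
    obtain e where e: "q = 2 * e" using \<open>even q\<close> by blast
    then have "(e - 1, k) \<in> (SIGMA d:{..<n}. {3..2*d + 2})" "q = 2 * (e - 1) + 2"
      using * by auto
    then show ?thesis unfolding params_1243_def by force
  qed
  then show ?thesis
    unfolding params_1243_def by auto
qed

lemma cycle_from_2_dumont4_avoiding:
  assumes "0 < n" "(k, q) \<in> params_1243 n"
  shows "cycle_from_2 k q \<in> dumont4_avoiding n [1,2,4,3]"
proof -
  note P = assms(2)[unfolded params_1243_iff[OF assms(1)]]
  have "cycle_from_2 k q permutes {1..2*n}"
    by (rule permutesI_inj_on)
      (use P assms(1) in \<open>auto simp: cycle_from_2_def inj_on_def split: if_splits\<close>)
  moreover have "even i \<and> even (cycle_from_2 k q i)" if "cycle_from_2 k q i < i" for i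
    using that P by (auto simp: cycle_from_2_def split: if_splits)
  moreover have False
    if "1 \<le> a" "a < b" "b < c" "c < d" "cycle_from_2 k q a < cycle_from_2 k q b"
      "cycle_from_2 k q b < cycle_from_2 k q d" "cycle_from_2 k q d < cycle_from_2 k q c"
    for a b c d
  proof -
    \<comment> \<open>Every inversion starts at position 2 or ends at \<open>q\<close>; here it is preceded by the smaller
      letters at \<open>a\<close> and \<open>b\<close>, which leaves no room for the value 2 at \<open>q\<close>.\<close>
    have "d = q"
      using that(1-4,7) P by (auto simp: cycle_from_2_def split: if_splits)
    then have "cycle_from_2 k q d \<le> 2"
      using P by (auto simp: cycle_from_2_def)
    moreover have "1 \<le> cycle_from_2 k q a"
      using that(1) P by (auto simp: cycle_from_2_def)
    ultimately show False using that(5,6) by linarith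
  qed
  ultimately show ?thesis
    unfolding dumont4_avoiding_def dumont4_def contains_pattern_1243_iff by blast
qed

text \<open>The odd value 3 sits at position 2 or 3. All letters at the positions considered are at least
  3, so 3 precedes the larger letter of any inversion among them and would complete it to a
  forbidden 132.\<close>

lemma dumont4_avoiding_1243_strict_mono:
  assumes av: "\<pi> \<in> dumont4_avoiding n [1,2,4,3]" and q: "\<pi> q = 2"
  shows "strict_mono_on ({3..2*n} - {q}) \<pi>"
proof (rule strict_mono_onI, rule ccontr)
  fix x y assume x: "x \<in> {3..2*n} - {q}" and y: "y \<in> {3..2*n} - {q}" and "x < y"
    and "\<not> \<pi> x < \<pi> y"
  have D: "\<pi> \<in> dumont4 n" using av by (simp add: dumont4_avoiding_def)
  have yx: "\<pi> y < \<pi> x"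
    using \<open>\<not> \<pi> x < \<pi> y\<close> \<open>x < y\<close> dumont4_inj[OF D, of x y] by linarith
  have "3 \<le> \<pi> y"
    using dumont4_ge_2[OF D, of y] dumont4_inj[OF D, of y q] y q by auto
  obtain t where t: "\<pi> t = 3"
    using permutes_surj[OF dumont4_permutes[OF D]] by (metis surj_def)
  have "t \<le> 3" using dumont4_odd_value[OF D, of t] t by simp
  moreover have "t \<noteq> 0" "t \<noteq> 1"
    using t dumont4_zero_fixed[OF D] dumont4_one_fixed[OF D] by (intro notI; auto)+
  ultimately have t23: "2 \<le> t" "t \<le> 3" by auto
  have "t \<noteq> x" using t \<open>3 \<le> \<pi> y\<close> yx by auto
  then have "t < x" using x t23 by auto
  moreover have "\<pi> t < \<pi> y"
    using \<open>3 \<le> \<pi> y\<close> t dumont4_inj[OF D, of t y] \<open>t < x\<close> \<open>x < y\<close> by linarith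
  ultimately show False
    using dumont4_avoiding_1243_no_132[OF av, of t x y] t23 \<open>x < y\<close> y yx by auto
qed

text \<open>If \<open>\<pi> 2\<close> exceeded \<open>q\<close>, the positions after \<open>q\<close>, where \<open>\<pi>\<close> increases from a value at least
  \<open>q + 1\<close> at the odd position \<open>q + 1\<close>, would already exhaust all the values after \<open>q\<close>.\<close>

lemma dumont4_avoiding_1243_le:
  assumes av: "\<pi> \<in> dumont4_avoiding n [1,2,4,3]" and n: "0 < n"
    and q: "\<pi> q = 2" "even q" "2 \<le> q"
  shows "\<pi> 2 \<le> q"
proof (rule ccontr)
  assume "\<not> \<pi> 2 \<le> q"
  have D: "\<pi> \<in> dumont4 n" using av by (simp add: dumont4_avoiding_def)
  note mono = dumont4_avoiding_1243_strict_mono[OF av q(1)]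
  have up: "q + 1 \<le> \<pi> i" if "i \<in> {q+1..2*n}" for i
  proof -
    have "\<pi> (q + 1) \<le> \<pi> i"
      by (rule strict_mono_on_leD[OF mono]) (use that q in auto)
    then show ?thesis using dumont4_odd_position[OF D, of "q + 1"] q by simp
  qed
  have "\<pi> ` {q+1..2*n} \<subseteq> {q+1..2*n}"
  proof
    fix v assume "v \<in> \<pi> ` {q+1..2*n}"
    then obtain i where "i \<in> {q+1..2*n}" "v = \<pi> i" by blast
    then show "v \<in> {q+1..2*n}" using up[of i] dumont4_in_range[OF D, of i] by auto
  qed
  then have "\<pi> ` {q+1..2*n} = {q+1..2*n}"
    by (intro endo_inj_surj) (auto intro: inj_onI simp: dumont4_inj[OF D])
  moreover have "\<pi> 2 \<in> {q+1..2*n}"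
    using dumont4_in_range[OF D, of 2] n \<open>\<not> \<pi> 2 \<le> q\<close> by auto
  ultimately obtain i where "i \<in> {q+1..2*n}" "\<pi> i = \<pi> 2" by (metis imageE)
  then show False using dumont4_inj[OF D, of i 2] q by auto
qed

lemma dumont4_avoiding_1243_is_cycle:
  assumes av: "\<pi> \<in> dumont4_avoiding n [1,2,4,3]" and n: "0 < n"
  shows "\<pi> \<in> (\<lambda>(k, q). cycle_from_2 k q) ` params_1243 n"
proof -
  have D: "\<pi> \<in> dumont4 n" using av by (simp add: dumont4_avoiding_def)
  obtain q where q: "\<pi> q = 2"
    using permutes_surj[OF dumont4_permutes[OF D]] by (metis surj_def)
  have "q \<noteq> 0" "q \<noteq> 1"
    using q dumont4_zero_fixed[OF D] dumont4_one_fixed[OF D] by (intro notI; auto)+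
  then have "2 \<le> q" by linarith
  then have "even q" using dumont4_deficiency_even(1)[OF D, of q] q by (cases "q = 2") auto
  have "q \<le> 2*n"
    using permutes_not_in[OF dumont4_permutes[OF D], of q] q n by (cases "q \<le> 2*n") auto
  define k where "k = \<pi> 2"
  have "k \<le> q" unfolding k_def
    using dumont4_avoiding_1243_le[OF av n q \<open>even q\<close> \<open>2 \<le> q\<close>] .
  have "2 \<le> k" unfolding k_def using dumont4_ge_2[OF D] by simp
  have "k = 2 \<longleftrightarrow> q = 2" unfolding k_def using q dumont4_inj[OF D, of 2 q] by auto
  then have P: "(k, q) \<in> params_1243 n"
    unfolding params_1243_iff[OF n] using \<open>2 \<le> k\<close> \<open>k \<le> q\<close> \<open>even q\<close> \<open>q \<le> 2*n\<close> by linarith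
  have "\<pi> = cycle_from_2 k q"
  proof (rule bij_eqI_strict_mono_on[where A = "{3..2*n} - {q}"])
    show "bij \<pi>" by (rule permutes_bij[OF dumont4_permutes[OF D]])
    show "bij (cycle_from_2 k q)"
      using cycle_from_2_dumont4_avoiding[OF n P]
      by (auto simp: dumont4_avoiding_def dest: dumont4_permutes intro: permutes_bij)
    show "strict_mono_on ({3..2*n} - {q}) \<pi>"
      by (rule dumont4_avoiding_1243_strict_mono[OF av q])
    show "strict_mono_on ({3..2*n} - {q}) (cycle_from_2 k q)"
      by (auto simp: strict_mono_on_def cycle_from_2_def)
    show "\<pi> x = cycle_from_2 k q x" if outside: "x \<notin> {3..2*n} - {q}" for x
    proof -
      consider "x = 0" | "x = 1" | "x = 2" | "x = q" | "2*n < x"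
        using outside by simp linarith
      then show ?thesis
      proof cases
        case 5
        then show ?thesis
          using permutes_not_in[OF dumont4_permutes[OF D], of x] n \<open>q \<le> 2*n\<close>
          by (auto simp: cycle_from_2_def)
      qed (use dumont4_zero_fixed[OF D] dumont4_one_fixed[OF D] q \<open>2 \<le> k\<close> \<open>2 \<le> q\<close> in
          \<open>auto simp: cycle_from_2_def k_def\<close>)
    qed
  qed
  with P show ?thesis by force
qed

lemma inj_on_cycle_from_2:
  assumes "0 < n"
  shows "inj_on (\<lambda>(k, q). cycle_from_2 k q) (params_1243 n)"
proof (rule inj_onI, clarify)
  fix k q k' q'
  assume P: "(k, q) \<in> params_1243 n" and P': "(k', q') \<in> params_1243 n"
    and eq: "cycle_from_2 k q = cycle_from_2 k' q'"
  note P = P[unfolded params_1243_iff[OF assms]] and P' = P'[unfolded params_1243_iff[OF assms]]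
  have "k = k'" using fun_cong[OF eq, of 2] by (simp add: cycle_from_2_def)
  moreover have "cycle_from_2 k' q' q = 2"
    using fun_cong[OF eq, of q] P by (auto simp: cycle_from_2_def)
  then have "q = q'" using P P' \<open>k = k'\<close> by (auto simp: cycle_from_2_def split: if_splits)
  ultimately show "k = k' \<and> q = q'" by simp
qed

section \<open>Avoiding 1324\<close>

text \<open>For \<open>s \<le> p < N\<close> this is the cycle \<open>s \<mapsto> s + 1 \<mapsto> \<dots> \<mapsto> p \<mapsto> N \<mapsto> s\<close>; the pair \<open>(N, N)\<close> gives
  the identity because the test for \<open>p\<close> comes first.\<close>

definition cycle_to_top :: "nat \<Rightarrow> nat \<Rightarrow> nat \<Rightarrow> nat \<Rightarrow> nat" where
  "cycle_to_top N s p i =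
     (if i = p then N else if i = N then s else if s \<le> i \<and> i < p then i + 1 else i)"

definition params_1324 :: "nat \<Rightarrow> (nat \<times> nat) set" where
  "params_1324 n =
     insert (2*n, 2*n) ((\<lambda>(d, p). (2*(n - d), p)) ` (SIGMA d:{..<n}. {2*(n - d)..<2*n}))"

lemma params_1324_iff:
  "(s, p) \<in> params_1324 n \<longleftrightarrow>
     s = 2*n \<and> p = 2*n \<or> 2 \<le> s \<and> even s \<and> s \<le> p \<and> p < 2*n"
proof -
  have "(s, p) \<in> params_1324 n" if *: "2 \<le> s" "even s" "s \<le> p" "p < 2*n"
  proof -
    obtain e where e: "s = 2 * e" using \<open>even s\<close> by blast
    then have "(n - e, p) \<in> (SIGMA d:{..<n}. {2*(n - d)..<2*n})" "s = 2 * (n - (n - e))"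
      using * by auto
    then show ?thesis unfolding params_1324_def by force
  qed
  then show ?thesis
    unfolding params_1324_def by auto
qed

lemma cycle_to_top_dumont4_avoiding:
  assumes "0 < n" "(s, p) \<in> params_1324 n"
  shows "cycle_to_top (2*n) s p \<in> dumont4_avoiding n [1,3,2,4]"
proof -
  let ?c = "cycle_to_top (2*n) s p"
  note P = assms(2)[unfolded params_1324_iff]
  have perm: "?c permutes {1..2*n}"
    by (rule permutesI_inj_on)
      (use P assms(1) in \<open>auto simp: cycle_to_top_def inj_on_def split: if_splits\<close>)
  moreover have "even i \<and> even (?c i)" if "?c i < i" "i \<in> {1..2*n}" for i
    using that P by (auto simp: cycle_to_top_def split: if_splits)
  moreover have False
    if "1 \<le> a" "a < b" "b < c" "c < d" "d \<le> 2*n" "?c c < ?c b" "?c b < ?c d"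
    for a b c d
  proof -
    \<comment> \<open>Every inversion starts at \<open>p\<close> or ends at the last position; the top value at \<open>p\<close> is too
      large.\<close>
    have "b = p"
      using that(1-6) P by (auto simp: cycle_to_top_def split: if_splits)
    then have "?c b = 2*n" by (simp add: cycle_to_top_def)
    moreover have "?c d \<le> 2*n"
      using permutes_in_image[OF perm, of d] that(1-5) by auto
    ultimately show False using that(7) by linarith
  qed
  ultimately show ?thesis
    unfolding dumont4_avoiding_def dumont4_def contains_pattern_1324_iff by blast
qed

lemma least_moved_point:
  fixes \<pi> :: "nat \<Rightarrow> nat"
  assumes "inj \<pi>" "\<pi> \<noteq> id"
  obtains s where "s < \<pi> s" "\<And>i. i < s \<Longrightarrow> \<pi> i = i"
proof -
  obtain j where j: "\<pi> j \<noteq> j" using assms(2) by fastforce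
  define s where "s = (LEAST i. \<pi> i \<noteq> i)"
  have s: "\<pi> s \<noteq> s" unfolding s_def by (rule LeastI[where P = "\<lambda>i. \<pi> i \<noteq> i"]) fact
  have below: "\<pi> i = i" if "i < s" for i
    using not_less_Least[OF that[unfolded s_def]] by simp
  have "s < \<pi> s"
    using s below[of "\<pi> s"] assms(1) by (metis inj_eq linorder_neqE_nat)
  then show ?thesis using that below by blast
qed

text \<open>If anything followed the value \<open>s\<close>, there would be a letter at least \<open>q + 1\<close> at the odd
  position \<open>q + 1\<close>, and avoiding 213 would force all letters between \<open>s\<close> and \<open>q\<close> above it. But the
  odd value \<open>s + 1\<close> sits at position \<open>s\<close> or \<open>s + 1\<close>, which is before \<open>q\<close>.\<close>

lemma dumont4_avoiding_1324_least_moved_last: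
  assumes av: "\<pi> \<in> dumont4_avoiding n [1,3,2,4]"
    and s: "s < \<pi> s" and below: "\<And>i. i < s \<Longrightarrow> \<pi> i = i"
  shows "\<pi> (2*n) = s" and "even s" and "2 \<le> s"
proof -
  have D: "\<pi> \<in> dumont4 n" using av by (simp add: dumont4_avoiding_def)
  obtain q where q: "\<pi> q = s"
    using permutes_surj[OF dumont4_permutes[OF D]] by (metis surj_def)
  have "q \<noteq> s" "\<not> q < s" using q s below[of q] by auto
  then have "s < q" by simp
  then have "even q" "even s"
    using dumont4_deficiency_even[OF D, of q] q by auto
  have "s \<noteq> 0" using s dumont4_zero_fixed[OF D] by (intro notI) auto
  then show "even s" "2 \<le> s" using \<open>even s\<close> by (auto elim: evenE)
  have "q \<le> 2*n"
    using permutes_not_in[OF dumont4_permutes[OF D], of q] q \<open>s < q\<close> by (cases "q \<le> 2*n") auto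
  have "q = 2*n"
  proof (rule ccontr)
    assume "q \<noteq> 2*n"
    then have "q + 1 \<le> 2*n" using \<open>q \<le> 2*n\<close> by simp
    have big: "q + 1 \<le> \<pi> (q + 1)"
      using dumont4_odd_position[OF D, of "q + 1"] \<open>even q\<close> by simp
    obtain t where t: "\<pi> t = s + 1"
      using permutes_surj[OF dumont4_permutes[OF D]] by (metis surj_def)
    have "t \<le> s + 1" using dumont4_odd_value[OF D, of t] t \<open>even s\<close> by simp
    moreover have "\<not> t < s" using below[of t] t by auto
    moreover have "s + 1 < q"
      using \<open>s < q\<close> \<open>even s\<close> \<open>even q\<close> by (metis Suc_eq_plus1 even_Suc less_antisym not_less_eq)
    ultimately have "2 \<le> t" "t < q" using \<open>2 \<le> s\<close> by auto
    moreover have "\<pi> q < \<pi> t" "\<pi> t < \<pi> (q + 1)"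
      using q t big \<open>s < q\<close> by auto
    ultimately show False
      using dumont4_avoiding_1324_no_213[OF av, of t q "q + 1"] \<open>q + 1 \<le> 2*n\<close> by auto
  qed
  then show "\<pi> (2*n) = s" using q by simp
qed

text \<open>An inversion completes to a forbidden 213, with the top value at \<open>p\<close> if it lies before
  \<open>p\<close>. Otherwise \<open>p < 2n - 1\<close>, and the odd position \<open>2n - 1\<close> can only carry the value \<open>2n - 1\<close>,
  which plays the same role.\<close>

lemma dumont4_avoiding_1324_strict_mono:
  assumes av: "\<pi> \<in> dumont4_avoiding n [1,3,2,4]" and p: "\<pi> p = 2*n"
    and "2 \<le> s"
  shows "strict_mono_on ({s..<2*n} - {p}) \<pi>"
proof (rule strict_mono_onI, rule ccontr)
  fix x y assume x: "x \<in> {s..<2*n} - {p}" and y: "y \<in> {s..<2*n} - {p}" and "x < y"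
    and "\<not> \<pi> x < \<pi> y"
  have D: "\<pi> \<in> dumont4 n" using av by (simp add: dumont4_avoiding_def)
  have yx: "\<pi> y < \<pi> x"
    using \<open>\<not> \<pi> x < \<pi> y\<close> \<open>x < y\<close> dumont4_inj[OF D, of x y] by linarith
  have below_top: "\<pi> i < 2*n" if "i \<in> {s..<2*n} - {p}" for i
    using that dumont4_in_range[OF D, of i] dumont4_inj[OF D, of i p] p \<open>2 \<le> s\<close>
    by (auto simp: order_less_le)
  show False
  proof (cases "y < p")
    case True
    have "p \<le> 2*n"
      using permutes_not_in[OF dumont4_permutes[OF D], of p] p by (cases "p \<le> 2*n") auto
    then show False
      using dumont4_avoiding_1324_no_213[OF av, of x y p] True \<open>x < y\<close> x yx p \<open>2 \<le> s\<close>
        below_top[OF x] by auto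
  next
    case False
    then have "2*n - 1 \<in> {s..<2*n} - {p}" using x y by auto
    moreover have "odd (2*n - 1)" using x by auto
    ultimately have last: "\<pi> (2*n - 1) = 2*n - 1"
      using dumont4_odd_position[OF D, of "2*n - 1"] below_top[of "2*n - 1"] by linarith
    have "\<pi> x < 2*n - 1"
      using below_top[OF x] last dumont4_inj[OF D, of x "2*n - 1"] \<open>x < y\<close> y by fastforce
    moreover have "y < 2*n - 1"
      using y yx last \<open>\<pi> x < 2*n - 1\<close> by (cases "y = 2*n - 1") auto
    ultimately show False
      using dumont4_avoiding_1324_no_213[OF av, of x y "2*n - 1"] \<open>x < y\<close> x yx last \<open>2 \<le> s\<close>
      by auto
  qed
qed

lemma dumont4_avoiding_1324_is_cycle:
  assumes av: "\<pi> \<in> dumont4_avoiding n [1,3,2,4]" and n: "0 < n"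
  shows "\<pi> \<in> (\<lambda>(s, p). cycle_to_top (2*n) s p) ` params_1324 n"
proof (cases "\<pi> = id")
  case True
  have "cycle_to_top (2*n) (2*n) (2*n) = id"
    by (auto simp: cycle_to_top_def fun_eq_iff)
  then show ?thesis
    using True by (auto simp: params_1324_def)
next
  case False
  have D: "\<pi> \<in> dumont4 n" using av by (simp add: dumont4_avoiding_def)
  obtain s where s: "s < \<pi> s" and below: "\<And>i. i < s \<Longrightarrow> \<pi> i = i"
    using least_moved_point[OF permutes_inj[OF dumont4_permutes[OF D]] False] by blast
  note last = dumont4_avoiding_1324_least_moved_last[OF av s below]
  have "s \<noteq> 2*n" using last(1) s by auto
  moreover have "s \<le> 2*n" using last(1) dumont4_in_range[OF D, of "2*n"] n by auto
  ultimately have "s < 2*n" by simp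
  obtain p where p: "\<pi> p = 2*n"
    using permutes_surj[OF dumont4_permutes[OF D]] by (metis surj_def)
  have "p \<noteq> 2*n" using p last(1) \<open>s < 2*n\<close> by auto
  have "p < 2*n"
    using permutes_not_in[OF dumont4_permutes[OF D], of p] p \<open>p \<noteq> 2*n\<close>
    by (cases "p \<le> 2*n") auto
  have "s \<le> p" using below[of p] p \<open>p \<noteq> 2*n\<close> by force
  have P: "(s, p) \<in> params_1324 n"
    unfolding params_1324_iff using last \<open>p < 2*n\<close> \<open>s \<le> p\<close> by simp
  have "\<pi> = cycle_to_top (2*n) s p"
  proof (rule bij_eqI_strict_mono_on[where A = "{s..<2*n} - {p}"])
    show "bij \<pi>" by (rule permutes_bij[OF dumont4_permutes[OF D]])
    show "bij (cycle_to_top (2*n) s p)"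
      using cycle_to_top_dumont4_avoiding[OF n P]
      by (auto simp: dumont4_avoiding_def dest: dumont4_permutes intro: permutes_bij)
    show "strict_mono_on ({s..<2*n} - {p}) \<pi>"
      by (rule dumont4_avoiding_1324_strict_mono[OF av p last(3)])
    show "strict_mono_on ({s..<2*n} - {p}) (cycle_to_top (2*n) s p)"
      by (auto simp: strict_mono_on_def cycle_to_top_def)
    show "\<pi> x = cycle_to_top (2*n) s p x" if outside: "x \<notin> {s..<2*n} - {p}" for x
    proof -
      consider "x < s" | "x = p" | "x = 2*n" | "2*n < x"
        using outside by simp linarith
      then show ?thesis
      proof cases
        case 4
        then show ?thesis
          using permutes_not_in[OF dumont4_permutes[OF D], of x] \<open>p < 2*n\<close>
          by (auto simp: cycle_to_top_def)
      qed (use below p last \<open>s \<le> p\<close> \<open>p < 2*n\<close> in \<open>auto simp: cycle_to_top_def\<close>)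
    qed
  qed
  with P show ?thesis by force
qed

lemma inj_on_cycle_to_top: "inj_on (\<lambda>(s, p). cycle_to_top (2*n) s p) (params_1324 n)"
proof (rule inj_onI, clarify)
  fix s p s' p'
  assume P: "(s, p) \<in> params_1324 n" and P': "(s', p') \<in> params_1324 n"
    and eq: "cycle_to_top (2*n) s p = cycle_to_top (2*n) s' p'"
  note P = P[unfolded params_1324_iff] and P' = P'[unfolded params_1324_iff]
  have "s = s'"
    using fun_cong[OF eq, of "2*n"] P P' by (auto simp: cycle_to_top_def split: if_splits)
  moreover have "cycle_to_top (2*n) s' p' p = 2*n"
    using fun_cong[OF eq, of p] by (simp add: cycle_to_top_def)
  then have "p = p'" using P P' \<open>s = s'\<close> by (auto simp: cycle_to_top_def split: if_splits)
  ultimately show "s = s' \<and> p = p'" by simp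
qed

section \<open>Counting\<close>

lemma sum_double_lessThan: "(\<Sum>d<n. 2 * d) = 2 * (n choose 2)" for n :: nat
  by (induction n) (simp_all add: numeral_2_eq_2)

lemma card_params_1243: "card (params_1243 n) = 2 * (n choose 2) + 1"
proof -
  let ?S = "SIGMA d:{..<n}. {3..2*d + 2}"
  have "inj_on (\<lambda>(d, k). (k, 2*d + 2)) ?S" by (auto simp: inj_on_def)
  moreover have "card ?S = (\<Sum>d<n. 2 * d)" by simp
  moreover have "(2, 2) \<notin> (\<lambda>(d, k). (k, 2*d + 2)) ` ?S" by auto
  ultimately show ?thesis
    unfolding params_1243_def by (simp add: card_image sum_double_lessThan)
qed

lemma card_params_1324: "card (params_1324 n) = 2 * (n choose 2) + 1"
proof -
  let ?S = "SIGMA d:{..<n}. {2*(n - d)..<2*n}"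
  have "inj_on (\<lambda>(d, p). (2*(n - d), p)) ?S" by (auto simp: inj_on_def)
  moreover have "card ?S = (\<Sum>d<n. 2 * d)" by (auto intro!: sum.cong)
  moreover have "(2*n, 2*n) \<notin> (\<lambda>(d, p). (2*(n - d), p)) ` ?S" by auto
  ultimately show ?thesis
    unfolding params_1324_def by (simp add: card_image sum_double_lessThan)
qed

lemma card_dumont4_avoiding_1243: "card (dumont4_avoiding n [1,2,4,3]) = 2 * (n choose 2) + 1"
proof (cases "n = 0")
  case True
  have "dumont4_avoiding 0 [1,2,4,3] = {id}"
    unfolding dumont4_avoiding_def dumont4_zero contains_pattern_1243_iff by auto
  then show ?thesis using True by simp
next
  case False
  then have "dumont4_avoiding n [1,2,4,3] = (\<lambda>(k, q). cycle_from_2 k q) ` params_1243 n"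
    using dumont4_avoiding_1243_is_cycle cycle_from_2_dumont4_avoiding by auto
  then show ?thesis
    using False card_image[OF inj_on_cycle_from_2] card_params_1243 by simp
qed

lemma card_dumont4_avoiding_1324: "card (dumont4_avoiding n [1,3,2,4]) = 2 * (n choose 2) + 1"
proof (cases "n = 0")
  case True
  have "dumont4_avoiding 0 [1,3,2,4] = {id}"
    unfolding dumont4_avoiding_def dumont4_zero contains_pattern_1324_iff by auto
  then show ?thesis using True by simp
next
  case False
  then have "dumont4_avoiding n [1,3,2,4] =
      (\<lambda>(s, p). cycle_to_top (2*n) s p) ` params_1324 n"
    using dumont4_avoiding_1324_is_cycle cycle_to_top_dumont4_avoiding by auto
  then show ?thesis
    using card_image[OF inj_on_cycle_to_top] card_params_1324 by simp
qed

lemma double_choose_two_int: "int (2 * (n choose 2) + 1) = (int n)\<^sup>2 - int n + 1"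
  by (induction n) (simp_all add: numeral_2_eq_2 algebra_simps)

theorem theorem3p9:
  fixes n :: nat
  shows "card (dumont4_avoiding n [1,2,4,3]) = card (dumont4_avoiding n [1,3,2,4])
    \<and> card (dumont4_avoiding n [1,3,2,4]) = 2 * (n choose 2) + 1
    \<and> int (2 * (n choose 2) + 1) = (int n)\<^sup>2 - int n + 1"
  using card_dumont4_avoiding_1243 card_dumont4_avoiding_1324 double_choose_two_int by simp

end
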